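(* Let $G$ be a finite non-abelian AC-group with centre $Z(G)$, and let $X_1, \dots, X_n$ be the distinct centralizers of non-central elements of $G$, indexed so that $|X_1| \leq \cdots \leq |X_n|$. Then the Laplacian spectrum of the non-commuting graph $\mathcal{A}_G$ of $G$ is $$\{0, (|G| - |X_n|)^{|X_n| - |Z(G)| - 1}, \dots, (|G| - |X_1|)^{|X_1| - |Z(G)| - 1}, (|G| - |Z(G)|)^{n - 1}\}.$$
   Context: A group $G$ is an AC-group if $C_G(x)$ is abelian for every $x \in G \setminus Z(G)$. For a finite non-abelian group $G$, the non-commuting graph $\mathcal{A}_G$ is the simple undirected graph with vertex set $G \setminus Z(G)$ in which two vertices $x,y$ are adjacent if and only if $xy \neq yx$. The Laplacian matrix of a finite graph is $D - A$, with $D$ the degree matrix and $A$ the adjacency matrix. The Laplacian spectrum is the multiset of eigenvalues of the Laplacian matrix; $\{\dots,\alpha^{a},\dots\}$ means the eigenvalue $\alpha$ is listed $a$ times (no exponent means once, exponent $0$ means the entry is absent, and if listed values coincide their multiplicities add). *)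

theory Defs
  imports
    "HOL-Algebra.Group"
    "Graph_Theory.Digraph"
    "Jordan_Normal_Form.Char_Poly"
begin

definition centralizer :: "('a, 'b) monoid_scheme \<Rightarrow> 'a \<Rightarrow> 'a set" where
  "centralizer G x = {g \<in> carrier G. g \<otimes>\<^bsub>G\<^esub> x = x \<otimes>\<^bsub>G\<^esub> g}"

definition centre :: "('a, 'b) monoid_scheme \<Rightarrow> 'a set" where
  "centre G = {z \<in> carrier G. \<forall>g \<in> carrier G. z \<otimes>\<^bsub>G\<^esub> g = g \<otimes>\<^bsub>G\<^esub> z}"

definition AC_group :: "('a, 'b) monoid_scheme \<Rightarrow> bool" where
  "AC_group G \<longleftrightarrow>
     group G \<and> (\<forall>x \<in> carrier G - centre G. comm_group (G\<lparr>carrier := centralizer G x\<rparr>))"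

text \<open>As in the AFP entry Graph_Theory, an undirected graph is a symmetric digraph: an edge is
  a pair of opposite arcs.\<close>

definition noncommuting_graph :: "('a, 'b) monoid_scheme \<Rightarrow> ('a, 'a \<times> 'a) pre_digraph" where
  "noncommuting_graph G =
     \<lparr>verts = carrier G - centre G,
      arcs = {(x, y). x \<in> carrier G - centre G \<and> y \<in> carrier G - centre G \<and>
                      x \<otimes>\<^bsub>G\<^esub> y \<noteq> y \<otimes>\<^bsub>G\<^esub> x},
      tail = fst, head = snd\<rparr>"

lemma graph_noncommuting_graph:
  assumes "finite (carrier G)"
  shows "graph (noncommuting_graph G)"
proof -
  have "arcs (noncommuting_graph G) \<subseteq> carrier G \<times> carrier G"
    by (auto simp: noncommuting_graph_def)
  then have fin: "finite (arcs (noncommuting_graph G))"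
    using assms by (meson finite_SigmaI finite_subset)
  show ?thesis
    by unfold_locales
      (use assms fin in \<open>auto simp: noncommuting_graph_def arc_to_ends_def symmetric_conv\<close>)
qed

text \<open>The matrices below are indexed by the positions in a list \<open>vs\<close> that enumerates the
  vertices without repetition. The out-degree is the degree, since graphs are symmetric.\<close>

definition adjacency_mat :: "('v, 'e) pre_digraph \<Rightarrow> 'v list \<Rightarrow> real mat" where
  "adjacency_mat \<Gamma> vs =
     mat (length vs) (length vs) (\<lambda>(i, j). if (vs ! i, vs ! j) \<in> arcs_ends \<Gamma> then 1 else 0)"

definition degree_mat :: "('v, 'e) pre_digraph \<Rightarrow> 'v list \<Rightarrow> real mat" where
  "degree_mat \<Gamma> vs =
     mat (length vs) (length vs) (\<lambda>(i, j). if i = j then real (out_degree \<Gamma> (vs ! i)) else 0)"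

definition laplacian_mat :: "('v, 'e) pre_digraph \<Rightarrow> 'v list \<Rightarrow> real mat" where
  "laplacian_mat \<Gamma> vs = degree_mat \<Gamma> vs - adjacency_mat \<Gamma> vs"

text \<open>All complex eigenvalues, each with its algebraic multiplicity.\<close>

definition eigenvalue_mset :: "real mat \<Rightarrow> complex multiset" where
  "eigenvalue_mset A = proots (char_poly (map_mat complex_of_real A))"

definition laplacian_spectrum :: "('v, 'e) pre_digraph \<Rightarrow> 'v list \<Rightarrow> complex multiset" where
  "laplacian_spectrum \<Gamma> vs = eigenvalue_mset (laplacian_mat \<Gamma> vs)"

end

theory Submission
  imports Defs
begin

text \<open>In an AC-group the centralizers of two commuting non-central elements coincide, so the
  non-commuting graph is complete multipartite: its parts are the sets \<open>X\<^sub>i - Z(G)\<close>. The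
  Laplacian of a complete multipartite graph on \<open>N\<close> vertices has an explicit basis of left
  eigenvectors: the all-ones vector (eigenvalue \<open>0\<close>), weighted differences of the indicator functions
  of two parts (eigenvalue \<open>N\<close>), and differences of two unit vectors in one part \<open>P\<close>
  (eigenvalue \<open>N - |P|\<close>). These vectors span, since a vector orthogonal to all of them is constant on
  each part, then constant, then zero.\<close>

section \<open>Diagonalisation by left eigenvectors\<close>

text \<open>Trivial kernel makes \<open>Q\<close> invertible, so \<open>A\<close> is similar to the
  diagonal matrix. The eigenvectors are the rows of \<open>Q\<close>, hence the kernel condition
  says that only zero is orthogonal to all of them.\<close>

lemma char_poly_left_eigenbasis:
  fixes A Q :: "'a :: field mat"
  assumes A: "A \<in> carrier_mat n n" and Q: "Q \<in> carrier_mat n n"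
    and eig: "Q * A = mat_diag n d * Q"
    and ker: "\<And>w. w \<in> carrier_vec n \<Longrightarrow> Q *\<^sub>v w = 0\<^sub>v n \<Longrightarrow> w = 0\<^sub>v n"
  shows "char_poly A = (\<Prod>i<n. [:- d i, 1:])"
proof -
  have "det Q \<noteq> 0"
    using det_0_iff_vec_prod_zero[OF Q] ker by blast
  from det_non_zero_imp_unit[OF Q this, of "()"] obtain P where
    P: "P \<in> carrier_mat n n" and PQ: "P * Q = 1\<^sub>m n" and QP: "Q * P = 1\<^sub>m n"
    unfolding Units_def ring_mat_def by auto
  have D: "mat_diag n d \<in> carrier_mat n n" by simp
  have "A = (P * Q) * A" using A PQ by simp
  also have "\<dots> = P * (Q * A)" using A P Q by (simp add: assoc_mult_mat)
  also have "\<dots> = P * mat_diag n d * Q" unfolding eig using assoc_mult_mat[OF P D Q] by simp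
  finally have "similar_mat A (mat_diag n d)"
    using A D P Q PQ QP by (intro similar_matI[of _ _ P Q n]) (auto simp only: insert_subset)
  then have "char_poly A = char_poly (mat_diag n d)" by (rule char_poly_similar)
  also have "\<dots> = (\<Prod>a\<leftarrow>diag_mat (mat_diag n d). [:- a, 1:])"
    by (rule char_poly_upper_triangular[OF D]) (auto simp: mat_diag_def)
  also have "diag_mat (mat_diag n d) = map d [0..<n]"
    by (auto simp: diag_mat_def mat_diag_def intro!: nth_equalityI)
  also have "(\<Prod>a\<leftarrow>map d [0..<n]. [:- a, 1:]) = (\<Prod>i<n. [:- d i, 1:])"
    by (simp add: comp_def prod.list_conv_set_nth atLeast0LessThan)
  finally show ?thesis .
qed

text \<open>Passes from list positions to vertices, so that later arguments can sum over
  \<open>V\<close>. Labelling the eigenfunctions \<open>q v\<close> by vertices makes the matrix of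
  eigenvectors square.\<close>

lemma proots_char_poly_eigenfunctions:
  fixes l q :: "'v \<Rightarrow> 'v \<Rightarrow> 'a :: field"
  assumes vs: "distinct vs" "set vs = V"
    and eig: "\<And>v u. v \<in> V \<Longrightarrow> u \<in> V \<Longrightarrow> (\<Sum>w\<in>V. q v w * l w u) = d v * q v u"
    and ker: "\<And>f u. (\<And>v. v \<in> V \<Longrightarrow> (\<Sum>u\<in>V. q v u * f u) = 0) \<Longrightarrow> u \<in> V \<Longrightarrow> f u = 0"
  shows "proots (char_poly (mat (length vs) (length vs) (\<lambda>(i, j). l (vs ! i) (vs ! j))))
           = image_mset d (mset_set V)"
proof -
  define n where "n = length vs"
  define A where "A = mat n n (\<lambda>(i, j). l (vs ! i) (vs ! j))"
  define Q where "Q = mat n n (\<lambda>(i, j). q (vs ! i) (vs ! j))"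
  have bij: "bij_betw (\<lambda>i. vs ! i) {..<n} V"
    using bij_betw_nth[OF vs(1)] vs(2) by (simp add: n_def)
  have sum_V: "(\<Sum>i<n. g (vs ! i)) = (\<Sum>v\<in>V. g v)" for g :: "'v \<Rightarrow> 'a"
    by (rule sum.reindex_bij_betw[OF bij])
  have in_V: "vs ! i \<in> V" if "i < n" for i
    using bij that by (auto simp: bij_betw_def)
  have A: "A \<in> carrier_mat n n" and Q: "Q \<in> carrier_mat n n"
    by (auto simp: A_def Q_def)
  have "Q * A = mat_diag n (\<lambda>i. d (vs ! i)) * Q"
  proof (rule eq_matI)
    fix i j
    assume "i < dim_row (mat_diag n (\<lambda>i. d (vs ! i)) * Q)"
      and "j < dim_col (mat_diag n (\<lambda>i. d (vs ! i)) * Q)"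
    then have ij: "i < n" "j < n" by (auto simp: Q_def mat_diag_def)
    have "(Q * A) $$ (i, j) = (\<Sum>k<n. q (vs ! i) (vs ! k) * l (vs ! k) (vs ! j))"
      using ij by (auto simp: Q_def A_def scalar_prod_def atLeast0LessThan)
    also have "\<dots> = d (vs ! i) * q (vs ! i) (vs ! j)"
      using eig[OF in_V in_V, OF ij] sum_V[of "\<lambda>w. q (vs ! i) w * l w (vs ! j)"] by simp
    finally show "(Q * A) $$ (i, j) = (mat_diag n (\<lambda>i. d (vs ! i)) * Q) $$ (i, j)"
      using ij by (simp add: mat_diag_mult_left[OF Q]) (simp add: Q_def)
  qed (auto simp: Q_def A_def mat_diag_def)
  moreover have "w = 0\<^sub>v n" if w: "w \<in> carrier_vec n" and Qw: "Q *\<^sub>v w = 0\<^sub>v n" for w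
  proof (rule eq_vecI)
    \<comment> \<open>Reads the vector \<open>w\<close> as a function on vertices, through the
      inverse of the enumeration \<open>vs\<close>.\<close>
    define f where "f u = w $ inv_into {..<n} (\<lambda>i. vs ! i) u" for u
    have f: "f (vs ! i) = w $ i" if "i < n" for i
      using bij_betw_inv_into_left[OF bij] that by (simp add: f_def)
    have orth: "(\<Sum>u\<in>V. q v u * f u) = 0" if "v \<in> V" for v
    proof -
      obtain i where i: "i < n" "v = vs ! i"
        using \<open>v \<in> V\<close> vs(2) by (auto simp: in_set_conv_nth n_def)
      have "(\<Sum>u\<in>V. q v u * f u) = (\<Sum>k<n. q v (vs ! k) * f (vs ! k))"
        by (rule sum_V[symmetric])
      also have "\<dots> = (Q *\<^sub>v w) $ i"
        using i w by (auto simp: Q_def scalar_prod_def f atLeast0LessThan intro!: sum.cong)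
      finally show ?thesis using i Qw by simp
    qed
    fix i assume "i < dim_vec (0\<^sub>v n :: 'a vec)"
    then show "w $ i = 0\<^sub>v n $ i"
      using f[of i] ker[OF orth in_V[of i]] by simp
  qed (use w in auto)
  ultimately have "char_poly A = (\<Prod>i<n. [:- d (vs ! i), 1:])"
    by (rule char_poly_left_eigenbasis[OF A Q])
  then have "proots (char_poly A) = (\<Sum>i<n. {#d (vs ! i)#})"
    by (simp add: proots_prod)
  also have "\<dots> = (\<Sum>v\<in>V. {#d v#})"
    by (rule sum.reindex_bij_betw[OF bij])
  also have "\<dots> = image_mset d (mset_set V)"
    by (simp add: sum_unfold_sum_mset)
  finally show ?thesis by (simp add: A_def n_def)
qed

section \<open>Degrees and multisets over disjoint unions\<close>

text \<open>Without parallel arcs, \<open>head G\<close> is injective on the arcs leaving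
  \<open>v\<close>.\<close>

lemma (in graph) out_degree_eq_card_neighbours:
  "out_degree G v = card {u. (v, u) \<in> arcs_ends G}"
proof -
  have "inj_on (head G) (out_arcs G v)"
    by (auto intro!: inj_onI no_multi_arcs simp: out_arcs_def arc_to_ends_def)
  moreover have "head G ` out_arcs G v = {u. (v, u) \<in> arcs_ends G}"
    by (force simp: out_arcs_def arcs_ends_def arc_to_ends_def)
  ultimately show ?thesis
    unfolding out_degree_def by (metis card_image)
qed

lemma image_mset_const_on:
  assumes "\<And>x. x \<in> A \<Longrightarrow> d x = c" "finite A"
  shows "image_mset d (mset_set A) = replicate_mset (card A) c"
proof -
  have "image_mset d (mset_set A) = image_mset (\<lambda>_. c) (mset_set A)"
    using assms by (intro image_mset_cong) auto
  then show ?thesis by (simp add: image_mset_const_eq)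
qed

lemma image_mset_mset_set_UNION:
  assumes "finite I" "\<And>i. i \<in> I \<Longrightarrow> finite (A i)" "disjoint_family_on A I"
  shows "image_mset d (mset_set (\<Union>i\<in>I. A i)) = (\<Sum>i\<in>I. image_mset d (mset_set (A i)))"
proof -
  have *: "image_mset d (mset_set S) = (\<Sum>x\<in>S. {#d x#})" for S
    by (simp add: sum_unfold_sum_mset)
  show ?thesis unfolding *
    using assms by (intro sum.UNION_disjoint) (auto simp: disjoint_family_on_def)
qed

section \<open>Laplacian spectrum of complete multipartite graphs\<close>

text \<open>The map \<open>p\<close> labels the parts by values of any type, so that centralizers
  can later serve as labels.\<close>

theorem laplacian_spectrum_complete_multipartite:
  fixes \<Gamma> :: "('v, 'e) pre_digraph" and p :: "'v \<Rightarrow> 'c"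
  defines "V \<equiv> verts \<Gamma>"
  defines "part \<equiv> \<lambda>c. {v \<in> V. p v = c}"
  assumes graph: "graph \<Gamma>"
    and arcs: "\<And>u v. u \<in> V \<Longrightarrow> v \<in> V \<Longrightarrow> (u, v) \<in> arcs_ends \<Gamma> \<longleftrightarrow> p u \<noteq> p v"
    and V_ne: "V \<noteq> {}"
    and vs: "distinct vs" "set vs = V"
  shows "laplacian_spectrum \<Gamma> vs =
           {#0#}
           + (\<Sum>c\<in>p ` V. replicate_mset (card (part c) - 1) (of_nat (card V) - of_nat (card (part c))))
           + replicate_mset (card (p ` V) - 1) (of_nat (card V))"
proof -
  interpret graph \<Gamma> by (rule graph)
  have fin: "finite V" by (simp add: V_def)
  have fin_part [simp]: "finite (part c)" for c
    using fin by (simp add: part_def)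
  define s :: "'c \<Rightarrow> complex" where "s c = of_nat (card (part c))" for c
  define N :: complex where "N = of_nat (card V)"
  \<comment> \<open>\<open>r\<close> picks a representative of each part; \<open>v0\<close> below
    represents the part \<open>c0\<close>, against which all weighted differences are taken.\<close>
  define r where "r = inv_into V p"
  have r: "r c \<in> V \<and> p (r c) = c" if "c \<in> p ` V" for c
    using that by (simp add: r_def inv_into_into f_inv_into_f)
  obtain c0 where c0: "c0 \<in> p ` V" using V_ne by auto
  define v0 where "v0 = r c0"
  have v0: "v0 \<in> V" "p v0 = c0" using r[OF c0] by (auto simp: v0_def)
  have s_ne: "s (p v) \<noteq> 0" if "v \<in> V" for v
    using that by (auto simp: s_def part_def fin)
  have N_ne: "N \<noteq> 0" using V_ne fin by (simp add: N_def)

  \<comment> \<open>Laplacian entries: on the diagonal the last term vanishes and the degree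
    \<open>N - s (p u)\<close> remains; off it, \<open>-1\<close> occurs exactly between distinct
    parts.\<close>
  define l :: "'v \<Rightarrow> 'v \<Rightarrow> complex" where
    "l w u = of_bool (w = u) * (N - s (p u)) - (1 - of_bool (p w = p u))" for w u
  \<comment> \<open>One eigenfunction per vertex: all-ones for \<open>v0\<close>, a weighted
    difference for every other representative, a difference of unit vectors for the rest.\<close>
  define q :: "'v \<Rightarrow> 'v \<Rightarrow> complex" where
    "q v u = (if v = v0 then 1
              else if v = r (p v) then s c0 * of_bool (p u = p v) - s (p v) * of_bool (p u = c0)
              else of_bool (u = v) - of_bool (u = r (p v)))" for v u
  define d :: "'v \<Rightarrow> complex" where
    "d v = (if v = v0 then 0 else if v = r (p v) then N else N - s (p v))" for v

  have sum_ind: "(\<Sum>w\<in>V. of_bool (p w = c)) = s c" for c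
  proof -
    have "part c = V \<inter> {w. p w = c}" by (auto simp: part_def)
    then show ?thesis by (simp add: s_def fin)
  qed
  have sum_unit: "(\<Sum>w\<in>V. of_bool (w = u) * g w) = g u" if "u \<in> V" for u and g :: "'v \<Rightarrow> complex"
  proof -
    have "V \<inter> {w. w = u} = {u}" using that by auto
    then show ?thesis by (simp add: fin)
  qed

  \<comment> \<open>The \<open>-1\<close> entries contribute minus the total of \<open>g\<close>
    plus its sum over the part of \<open>u\<close>, so each eigenfunction needs only these two
    sums.\<close>
  have apply_l: "(\<Sum>w\<in>V. g w * l w u)
      = g u * (N - s (p u)) - (\<Sum>w\<in>V. g w) + (\<Sum>w\<in>V. of_bool (p w = p u) * g w)"
    if "u \<in> V" for g u
  proof -
    have "(\<Sum>w\<in>V. g w * l w u)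
        = (\<Sum>w\<in>V. of_bool (w = u) * (g w * (N - s (p u))) - g w + of_bool (p w = p u) * g w)"
      by (intro sum.cong) (auto simp: l_def algebra_simps)
    also have "\<dots> = (\<Sum>w\<in>V. of_bool (w = u) * (g w * (N - s (p u)))) - (\<Sum>w\<in>V. g w)
        + (\<Sum>w\<in>V. of_bool (p w = p u) * g w)"
      by (simp only: sum.distrib sum_subtractf)
    finally show ?thesis using sum_unit[OF that] by simp
  qed

  have eig: "(\<Sum>w\<in>V. q v w * l w u) = d v * q v u" if v: "v \<in> V" and u: "u \<in> V" for v u
  proof -
    consider "v = v0" | "v \<noteq> v0" "v = r (p v)" | "v \<noteq> v0" "v \<noteq> r (p v)" by blast
    then show ?thesis
    proof cases
      case 1
      then show ?thesis
        using apply_l[OF u, of "\<lambda>_. 1"] sum_ind[of "p u"] by (simp add: q_def d_def N_def)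
    next
      case 2
      have ne: "p v \<noteq> c0" using 2 v0_def by auto
      have q: "q v = (\<lambda>u. s c0 * of_bool (p u = p v) - s (p v) * of_bool (p u = c0))"
        using 2 by (auto simp: q_def)
      \<comment> \<open>Each of the two parts is weighted by the size of the other, so the
        contributions cancel.\<close>
      have tot: "(\<Sum>w\<in>V. q v w) = 0"
        unfolding q sum_subtractf sum_distrib_left[symmetric] sum_ind by simp
      \<comment> \<open>\<open>q v\<close> is constant on parts, so its part sum cancels
        \<open>- s (p u) * q v u\<close> and the eigenvalue \<open>N\<close> remains.\<close>
      have "(\<Sum>w\<in>V. of_bool (p w = p u) * q v w) = (\<Sum>w\<in>V. of_bool (p w = p u) * q v u)"
        by (intro sum.cong) (auto simp: q)
      also have "\<dots> = s (p u) * q v u"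
        by (simp only: sum_ind flip: sum_distrib_right)
      finally show ?thesis
        using 2 unfolding apply_l[OF u] tot by (simp add: d_def algebra_simps)
    next
      case 3
      have rv: "r (p v) \<in> V" "p (r (p v)) = p v" using r v by auto
      have q: "q v = (\<lambda>u. of_bool (u = v) - of_bool (u = r (p v)))"
        using 3 by (auto simp: q_def)
      have tot: "(\<Sum>w\<in>V. q v w) = 0"
        using sum_unit[OF v, of "\<lambda>_. 1"] sum_unit[OF rv(1), of "\<lambda>_. 1"]
        by (simp add: q sum_subtractf del: sum_of_bool_eq sum_of_bool_mult_eq)
      \<comment> \<open>\<open>v\<close> and \<open>r (p v)\<close> share a part, so their unit
        vectors cancel in every part sum.\<close>
      have "(\<Sum>w\<in>V. of_bool (p w = p u) * q v w)
          = (\<Sum>w\<in>V. of_bool (w = v) * of_bool (p w = p u) - of_bool (w = r (p v)) * of_bool (p w = p u))"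
        by (intro sum.cong) (auto simp: q)
      also have "\<dots> = 0"
        unfolding sum_subtractf sum_unit[OF v] sum_unit[OF rv(1)] by (simp add: rv)
      finally have "(\<Sum>w\<in>V. q v w * l w u) = q v u * (N - s (p u))"
        unfolding apply_l[OF u] tot by simp
      \<comment> \<open>\<open>q v\<close> vanishes outside the part of \<open>v\<close>, which
        frees the eigenvalue from \<open>u\<close>.\<close>
      also have "\<dots> = q v u * (N - s (p v))"
        using rv by (auto simp: q)
      finally show ?thesis using 3 by (simp add: d_def)
    qed
  qed

  have ker: "f u = 0" if orth: "\<And>v. v \<in> V \<Longrightarrow> (\<Sum>u\<in>V. q v u * f u) = 0" and u: "u \<in> V" for f u
  proof -
    have rep: "f v = f (r (p v))" if v: "v \<in> V" for v
    proof (cases "v = r (p v)")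
      case False
      then have "v \<noteq> v0" using r[OF c0] by (auto simp: v0_def)
      then have "(\<Sum>u\<in>V. q v u * f u) = (\<Sum>u\<in>V. of_bool (u = v) * f u - of_bool (u = r (p v)) * f u)"
        using False by (intro sum.cong) (auto simp: q_def)
      also have "\<dots> = f v - f (r (p v))"
        using sum_unit[OF v] sum_unit[of "r (p v)"] r v by (simp only: sum_subtractf) simp
      finally show ?thesis using orth[OF v] by simp
    qed simp
    \<comment> \<open>By \<open>rep\<close>, \<open>f\<close> is constant on parts; for
      \<open>c\<close> outside the image of \<open>p\<close> both sides are 0.\<close>
    have sum_f: "(\<Sum>w\<in>V. of_bool (p w = c) * f w) = s c * f (r c)" for c
    proof -
      have "(\<Sum>w\<in>V. of_bool (p w = c) * f w) = (\<Sum>w\<in>V. of_bool (p w = c) * f (r c))"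
      proof (intro sum.cong refl)
        fix w assume "w \<in> V"
        from rep[OF this] show "of_bool (p w = c) * f w = of_bool (p w = c) * f (r c)" by auto
      qed
      then show ?thesis by (simp only: sum_ind flip: sum_distrib_right)
    qed
    have const: "f v = f v0" if v: "v \<in> V" for v
    proof (cases "r (p v) = v0")
      case True
      then show ?thesis using rep[OF v] by simp
    next
      case False
      \<comment> \<open>The row of \<open>v\<close> itself may be a difference of unit vectors; that
        of its representative is a weighted difference.\<close>
      define v' where "v' = r (p v)"
      have v': "v' \<in> V" "p v' = p v" using r v by (auto simp: v'_def)
      have "v' \<noteq> v0" "v' = r (p v')" using False v' by (simp_all add: v'_def)
      then have "(\<Sum>u\<in>V. q v' u * f u)
          = (\<Sum>u\<in>V. s c0 * (of_bool (p u = p v) * f u) - s (p v) * (of_bool (p u = c0) * f u))"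
        using v' by (intro sum.cong) (auto simp: q_def algebra_simps)
      also have "\<dots> = s c0 * (s (p v) * f v) - s (p v) * (s c0 * f v0)"
        unfolding sum_subtractf sum_distrib_left[symmetric] sum_f using rep[OF v] by (simp add: v0_def)
      also have "\<dots> = s c0 * s (p v) * (f v - f v0)" by (simp add: algebra_simps)
      finally show ?thesis
        using orth[OF v'(1)] s_ne[OF v] s_ne[OF v0(1)] v0(2) by simp
    qed
    \<comment> \<open>The row of \<open>v0\<close> is all-ones, which kills the one remaining
      constant.\<close>
    have "0 = (\<Sum>u\<in>V. f u)" using orth[OF v0(1)] by (simp add: q_def)
    also have "\<dots> = (\<Sum>u\<in>V. f v0)" by (rule sum.cong[OF refl const])
    also have "\<dots> = N * f v0" by (simp add: N_def)
    finally show ?thesis using N_ne const[OF u] by simp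
  qed

  have deg: "of_nat (out_degree \<Gamma> v) = N - s (p v)" if v: "v \<in> V" for v
  proof -
    have "{u. (v, u) \<in> arcs_ends \<Gamma>} = V - part (p v)"
      using arcs[OF v] by (auto simp: part_def V_def dest: adj_in_verts)
    then have "out_degree \<Gamma> v = card V - card (part (p v))"
      by (simp add: out_degree_eq_card_neighbours card_Diff_subset part_def fin)
    moreover have "card (part (p v)) \<le> card V"
      by (rule card_mono) (auto simp: part_def fin)
    ultimately show ?thesis by (simp add: N_def s_def of_nat_diff)
  qed
  have proots: "proots (char_poly (mat (length vs) (length vs) (\<lambda>(i, j). l (vs ! i) (vs ! j))))
      = image_mset d (mset_set V)"
  proof (rule proots_char_poly_eigenfunctions[where q = q, OF vs])
    fix f u
    assume "\<And>v. v \<in> V \<Longrightarrow> (\<Sum>u\<in>V. q v u * f u) = 0" "u \<in> V"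
    then show "f u = 0" by (rule ker)
  qed (rule eig)
  have "map_mat complex_of_real (laplacian_mat \<Gamma> vs)
      = mat (length vs) (length vs) (\<lambda>(i, j). l (vs ! i) (vs ! j))"
  proof (rule eq_matI)
    fix i j
    assume "i < dim_row (mat (length vs) (length vs) (\<lambda>(i, j). l (vs ! i) (vs ! j)))"
      and "j < dim_col (mat (length vs) (length vs) (\<lambda>(i, j). l (vs ! i) (vs ! j)))"
    then have ij: "i < length vs" "j < length vs" by auto
    then have "vs ! i \<in> V" "vs ! j \<in> V" using vs by auto
    \<comment> \<open>Distinctness of \<open>vs\<close> makes equal positions and equal vertices the
      same, as the diagonal of \<open>l\<close> requires.\<close>
    then show "map_mat complex_of_real (laplacian_mat \<Gamma> vs) $$ (i, j)
        = mat (length vs) (length vs) (\<lambda>(i, j). l (vs ! i) (vs ! j)) $$ (i, j)"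
      using ij arcs deg nth_eq_iff_index_eq[OF vs(1) ij]
      by (auto simp: laplacian_mat_def degree_mat_def adjacency_mat_def l_def)
  qed (auto simp: laplacian_mat_def degree_mat_def adjacency_mat_def)
  then have "laplacian_spectrum \<Gamma> vs = image_mset d (mset_set V)"
    unfolding laplacian_spectrum_def eigenvalue_mset_def
    using proots by simp

  \<comment> \<open>Multiplicities of the eigenvalues\<close>
  also have "image_mset d (mset_set V)
      = {#0#} + (\<Sum>c\<in>p ` V. replicate_mset (card (part c) - 1) (N - s c))
        + replicate_mset (card (p ` V) - 1) N"
  proof -
    \<comment> \<open>\<open>?R\<close> holds the representatives other than \<open>v0\<close>,
      \<open>?P c\<close> the non-representatives of part \<open>c\<close>. The one vertex removed
      from each is the \<open>- 1\<close> in the multiplicities.\<close>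
    let ?P = "\<lambda>c. part c - {r c}" and ?R = "r ` (p ` V) - {v0}"
    have d_v0: "d v0 = 0" by (simp add: d_def)
    have inj_r: "inj_on r (p ` V)"
      using r by (intro inj_onI) metis
    have V_eq: "V = insert v0 ?R \<union> (\<Union>c\<in>p ` V. ?P c)"
      using v0 r by (auto simp: part_def)
    have disj: "insert v0 ?R \<inter> (\<Union>c\<in>p ` V. ?P c) = {}"
      using r c0 by (auto simp: part_def v0_def)
    have "mset_set (insert v0 ?R) = add_mset v0 (mset_set ?R)"
      by (rule mset_set.insert) (use fin in auto)
    moreover have "mset_set (insert v0 ?R \<union> (\<Union>c\<in>p ` V. ?P c))
        = mset_set (insert v0 ?R) + mset_set (\<Union>c\<in>p ` V. ?P c)"
      by (rule mset_set_Union) (use disj fin in auto)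
    ultimately have "image_mset d (mset_set V)
        = {#d v0#} + image_mset d (mset_set ?R) + image_mset d (mset_set (\<Union>c\<in>p ` V. ?P c))"
      by (subst V_eq) simp
    also have "image_mset d (mset_set ?R) = replicate_mset (card ?R) N"
      using r fin by (intro image_mset_const_on) (auto simp: d_def)
    also have "card ?R = card (p ` V) - 1"
      using c0 by (simp add: v0_def card_image[OF inj_r])
    also have "image_mset d (mset_set (\<Union>c\<in>p ` V. ?P c)) = (\<Sum>c\<in>p ` V. image_mset d (mset_set (?P c)))"
      by (rule image_mset_mset_set_UNION) (auto simp: fin disjoint_family_on_def part_def)
    also have "\<dots> = (\<Sum>c\<in>p ` V. replicate_mset (card (part c) - 1) (N - s c))"
    proof (rule sum.cong)
      fix c assume c: "c \<in> p ` V"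
      have "r c \<in> part c" using r[OF c] by (simp add: part_def)
      moreover have "image_mset d (mset_set (?P c)) = replicate_mset (card (?P c)) (N - s c)"
        using r[OF c] v0 fin by (intro image_mset_const_on) (auto simp: d_def part_def v0_def)
      ultimately show "image_mset d (mset_set (?P c)) = replicate_mset (card (part c) - 1) (N - s c)"
        by simp
    qed simp
    finally show ?thesis unfolding d_v0 by (simp add: ac_simps)
  qed
  finally show ?thesis by (simp add: N_def s_def)
qed

section \<open>Centralizers in AC-groups\<close>

text \<open>If \<open>w\<close> commutes with \<open>u\<close>, it lies in the abelian group
  \<open>centralizer G u\<close>, all of which therefore commutes with \<open>w\<close>; exchanging
  the roles gives the reverse inclusion.\<close>

lemma AC_group_centralizer_eq_iff:
  assumes AC: "AC_group G" and x: "x \<in> carrier G - centre G" and y: "y \<in> carrier G - centre G"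
  shows "centralizer G x = centralizer G y \<longleftrightarrow> x \<otimes>\<^bsub>G\<^esub> y = y \<otimes>\<^bsub>G\<^esub> x"
proof
  assume "centralizer G x = centralizer G y"
  moreover have "x \<in> centralizer G x" using x by (simp add: centralizer_def)
  ultimately show "x \<otimes>\<^bsub>G\<^esub> y = y \<otimes>\<^bsub>G\<^esub> x" by (simp add: centralizer_def)
next
  have sub: "centralizer G u \<subseteq> centralizer G w"
    if u: "u \<in> carrier G - centre G" and w: "w \<in> carrier G - centre G"
      and uw: "w \<otimes>\<^bsub>G\<^esub> u = u \<otimes>\<^bsub>G\<^esub> w" for u w
  proof
    fix g assume g: "g \<in> centralizer G u"
    interpret C: comm_group "G\<lparr>carrier := centralizer G u\<rparr>"
      using AC u by (simp add: AC_group_def)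
    have "w \<in> centralizer G u" using w uw by (simp add: centralizer_def)
    then have "g \<otimes>\<^bsub>G\<^esub> w = w \<otimes>\<^bsub>G\<^esub> g" using C.m_comm[of g w] g by simp
    then show "g \<in> centralizer G w" using g by (simp add: centralizer_def)
  qed
  assume "x \<otimes>\<^bsub>G\<^esub> y = y \<otimes>\<^bsub>G\<^esub> x"
  then show "centralizer G x = centralizer G y"
    using sub[OF x y] sub[OF y x] by auto
qed

section \<open>Spectrum of the non-commuting graph\<close>

theorem theorem2p4:
  fixes G :: "('a, 'b) monoid_scheme"
    and X :: "nat \<Rightarrow> 'a set"
    and n :: nat
    and vs :: "'a list"
  assumes "AC_group G"
    and "finite (carrier G)"
    and "\<not> comm_group G"
    and "bij_betw X {1..n} (centralizer G ` (carrier G - centre G))"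
    and "mono_on {1..n} (\<lambda>i. card (X i))"
    and "distinct vs"
    and "set vs = verts (noncommuting_graph G)"
  shows "laplacian_spectrum (noncommuting_graph G) vs =
           {#0#}
           + (\<Sum>i = 1..n. replicate_mset (card (X i) - card (centre G) - 1)
                            (of_nat (card (carrier G)) - of_nat (card (X i))))
           + replicate_mset (n - 1) (of_nat (card (carrier G)) - of_nat (card (centre G)))"
proof -
  let ?V = "carrier G - centre G" and ?Z = "centre G" and ?\<Gamma> = "noncommuting_graph G"
  have G: "group G" using assms(1) by (simp add: AC_group_def)
  have fin: "finite (carrier G)" by (rule assms(2))
  have Z_sub: "?Z \<subseteq> carrier G" by (auto simp: centre_def)
  have finZ: "finite ?Z" using fin Z_sub by (rule rev_finite_subset)
  have verts: "verts ?\<Gamma> = ?V" by (simp add: noncommuting_graph_def)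
  have V_ne: "?V \<noteq> {}"
  proof
    assume "?V = {}"
    then have "comm_group G"
      using G by (intro group.group_comm_groupI) (auto simp: centre_def)
    with assms(3) show False by simp
  qed
  have arcs: "(u, v) \<in> arcs_ends ?\<Gamma> \<longleftrightarrow> centralizer G u \<noteq> centralizer G v"
    if "u \<in> ?V" "v \<in> ?V" for u v
    using that AC_group_centralizer_eq_iff[OF assms(1) that]
    by (force simp: noncommuting_graph_def arcs_ends_def arc_to_ends_def)
  have X_img: "X ` {1..n} = centralizer G ` ?V" and X_inj: "inj_on X {1..n}"
    using assms(4) by (auto simp: bij_betw_def)
  \<comment> \<open>With \<open>X i = centralizer G x\<close>, a non-central \<open>v\<close> has
    this centralizer iff it commutes with \<open>x\<close>, that is, iff it lies in
    \<open>X i\<close>.\<close>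
  have part: "{v \<in> ?V. centralizer G v = X i} = X i - ?Z \<and> ?Z \<subseteq> X i \<and> X i \<subseteq> carrier G"
    if i: "i \<in> {1..n}" for i
  proof -
    obtain x where x: "x \<in> ?V" and Xi: "X i = centralizer G x" using X_img i by blast
    have "{v \<in> ?V. centralizer G v = X i} = X i - ?Z"
      using AC_group_centralizer_eq_iff[OF assms(1) _ x] x by (auto simp: Xi centralizer_def)
    then show ?thesis using x by (auto simp: Xi centralizer_def centre_def)
  qed
  \<comment> \<open>The bound on \<open>card ?Z\<close> lets truncated subtraction of naturals
    become subtraction of complex numbers.\<close>
  have card_part: "card {v \<in> ?V. centralizer G v = X i} = card (X i) - card ?Z" and
    Z_le: "card ?Z \<le> card (X i)" if i: "i \<in> {1..n}" for i
  proof -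
    show "card {v \<in> ?V. centralizer G v = X i} = card (X i) - card ?Z"
      using part[OF i] finZ by (simp add: card_Diff_subset)
    show "card ?Z \<le> card (X i)"
      using part[OF i] fin by (meson card_mono finite_subset)
  qed
  have card_V: "card ?V = card (carrier G) - card ?Z" and Z_le_G: "card ?Z \<le> card (carrier G)"
    using Z_sub finZ fin by (auto simp: card_Diff_subset card_mono)
  have "laplacian_spectrum ?\<Gamma> vs = {#0#}
      + (\<Sum>c\<in>centralizer G ` ?V. replicate_mset (card {v \<in> ?V. centralizer G v = c} - 1)
           (of_nat (card ?V) - of_nat (card {v \<in> ?V. centralizer G v = c})))
      + replicate_mset (card (centralizer G ` ?V) - 1) (of_nat (card ?V))"
    using laplacian_spectrum_complete_multipartite[OF graph_noncommuting_graph[OF fin], unfolded verts,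
        OF arcs V_ne assms(6) assms(7)[unfolded verts]] .
  \<comment> \<open>Reindexes along the bijection \<open>X\<close>; the order of the centre cancels
    in the difference of \<open>card ?V\<close> and the part size.\<close>
  also have "(\<Sum>c\<in>centralizer G ` ?V. replicate_mset (card {v \<in> ?V. centralizer G v = c} - 1)
           (of_nat (card ?V) - of_nat (card {v \<in> ?V. centralizer G v = c}) :: complex))
      = (\<Sum>i = 1..n. replicate_mset (card (X i) - card ?Z - 1)
           (of_nat (card (carrier G)) - of_nat (card (X i))))"
    unfolding X_img[symmetric] sum.reindex[OF X_inj]
    using card_part Z_le by (intro sum.cong) (simp_all add: card_V Z_le_G of_nat_diff)
  also have "card (centralizer G ` ?V) = n"
    unfolding X_img[symmetric] card_image[OF X_inj] by simp
  finally show ?thesis by (simp add: card_V Z_le_G of_nat_diff)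
qed

end
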